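(* For every cactus $G$ with maximum degree $\Delta$, the square $G^2$ is $\max(\Delta,4)$-degenerate. Hence $\operatorname{ch}(G^2)\le \Delta+1$ if $\Delta\ge 4$, and $\operatorname{ch}(G^2)\le 5$ if $\Delta\le 3$.
   Context: Graphs are finite and simple. A cactus is a connected graph in which every edge lies on at most one cycle; equivalently, every block (maximal $2$-connected subgraph, where a single bridge edge also counts as a block) is an edge or a cycle. The square $G^2$ of a graph $G$ has vertex set $V(G)$, with $uv\in E(G^2)$ if and only if $1\le d_G(u,v)\le 2$, where $d_G(u,v)$ is the distance in $G$. A graph $H$ is $d$-degenerate if every (nonempty) subgraph of $H$ has a vertex of degree at most $d$ in that subgraph; equivalently, there is an ordering of $V(H)$ in which each vertex has at most $d$ neighbors later in the ordering. $\operatorname{ch}(H)$ is the choice (list-chromatic) number of $H$: the least $k$ such that for every assignment of lists $L(v)$ with $|L(v)|\ge k$ to the vertices of $H$ there is a proper coloring of $H$ in which each vertex $v$ receives a color from $L(v)$. *)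

theory Defs
  imports "Graph_Theory.Graph_Theory"
begin

text \<open>
  Finite simple graphs are values of type 'a pair_pre_digraph satisfying \<^const>\<open>pair_graph\<close>:
  finite, loop-free, without parallel arcs, and symmetric, the edge uv being the pair of arcs
  (u, v), (v, u). The null graph satisfies \<^const>\<open>pair_graph\<close>, but it is not \<^const>\<open>connected\<close>.
\<close>

definition edges_of :: "'a rel \<Rightarrow> 'a set set" where
  "edges_of A = (\<lambda>(u, v). {u, v}) ` A"

text \<open>
  Cycles are identified with their edge sets, so that the choice of starting vertex and direction
  is immaterial. The length bound is needed because \<^const>\<open>pre_digraph.cycle\<close> admits the closed
  walk u, v, u along a single edge.
\<close>

definition cycles :: "'a pair_pre_digraph \<Rightarrow> 'a set set set" where
  "cycles G = {edges_of (set p) | p. pre_digraph.cycle (with_proj G) p \<and> 3 \<le> length p}"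

definition cactus :: "'a pair_pre_digraph \<Rightarrow> bool" where
  "cactus G \<longleftrightarrow> pair_graph G \<and> connected (with_proj G) \<and>
     (\<forall>e\<in>edges_of (parcs G). \<exists>\<^sub>\<le>\<^sub>1 C. C \<in> cycles G \<and> e \<in> C)"

definition graph_dist :: "'a pair_pre_digraph \<Rightarrow> 'a \<Rightarrow> 'a \<Rightarrow> ereal" where
  "graph_dist G u v = wf_digraph.\<mu> (with_proj G) (\<lambda>_. 1) u v"

definition graph_square :: "'a pair_pre_digraph \<Rightarrow> 'a pair_pre_digraph" where
  "graph_square G = \<lparr> pverts = pverts G,
     parcs = {(u, v). u \<in> pverts G \<and> v \<in> pverts G \<and> 1 \<le> graph_dist G u v \<and> graph_dist G u v \<le> 2} \<rparr>"

text \<open>In a symmetric digraph the out-degree of a vertex is its degree as an undirected graph.\<close>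

definition max_degree :: "'a pair_pre_digraph \<Rightarrow> nat" where
  "max_degree G = Max (out_degree (with_proj G) ` pverts G)"

definition degenerate :: "nat \<Rightarrow> 'a pair_pre_digraph \<Rightarrow> bool" where
  "degenerate d H \<longleftrightarrow>
     (\<forall>H'. pair_graph H' \<and> subgraph (with_proj H') (with_proj H) \<and> pverts H' \<noteq> {} \<longrightarrow>
        (\<exists>v\<in>pverts H'. out_degree (with_proj H') v \<le> d))"

text \<open>
  Lists are finite sets of colours. For finite graphs only finitely many colours occur in a list
  assignment, so taking the natural numbers as colours is no restriction.
\<close>

definition choosable :: "'a pair_pre_digraph \<Rightarrow> nat \<Rightarrow> bool" where
  "choosable H k \<longleftrightarrow>
     (\<forall>L :: 'a \<Rightarrow> nat set. (\<forall>v\<in>pverts H. finite (L v) \<and> k \<le> card (L v)) \<longrightarrow>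
        (\<exists>c. (\<forall>v\<in>pverts H. c v \<in> L v) \<and> (\<forall>(u, v)\<in>parcs H. c u \<noteq> c v)))"

text \<open>A finite graph is k-choosable for k the number of its vertices, so the minimum exists.\<close>

definition choice_number :: "'a pair_pre_digraph \<Rightarrow> nat" where
  "choice_number H = (LEAST k. choosable H k)"

end

theory Submission
  imports Defs
begin

text \<open>
  Given a nonempty vertex set S, choose a vertex p and a component K of G - p meeting S, with K as
  small as possible. If K contains no vertex of S other than neighbours of p, then such a neighbour
  v sees in S, within distance two, at most p and the remaining neighbours of p, hence at most
  \<open>\<Delta>\<close> vertices. Otherwise let s in K be a vertex of S not adjacent to p. By minimality no q in K
  separates a vertex of S in K from p. Hence p and s lie on a common cycle C, and everything in S
  within distance two of s lies on C as well, because a cycle of a cactus has neither chords nor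
  ears; so s has at most four such vertices. Finally, d-degeneracy allows greedy colouring from
  lists of size d + 1.
\<close>

section \<open>Reachability and cycles in relations\<close>

text \<open>Serves to cut a walk where it first meets a cycle or a given vertex.\<close>

lemma rtrancl_first_hit:
  assumes "(s, z) \<in> R\<^sup>*" "s \<notin> X" "z \<in> X"
  obtains y x where "(s, y) \<in> (Restr R (- X))\<^sup>*" "(y, x) \<in> R" "y \<notin> X" "x \<in> X"
proof -
  \<comment> \<open>Invariant along the walk: either \<open>X\<close> has been entered, or
    everything so far lies outside it.\<close>
  have "(\<exists>y x. (s, y) \<in> (Restr R (- X))\<^sup>* \<and> (y, x) \<in> R \<and> y \<notin> X \<and> x \<in> X) \<or>
    z \<notin> X \<and> (s, z) \<in> (Restr R (- X))\<^sup>*"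
    using assms(1)
  proof (induction rule: rtrancl_induct)
    case base
    then show ?case using assms(2) by auto
  next
    case (step y z)
    show ?case
    proof (cases "z \<in> X")
      case True
      then show ?thesis using step by blast
    next
      case False
      then have "(y, z) \<in> Restr R (- X)" if "y \<notin> X" using step(2) that by auto
      then show ?thesis using step.IH False by (meson rtrancl.rtrancl_into_rtrancl)
    qed
  qed
  then show thesis using assms(3) that by blast
qed

lemma rtrancl_distinct_path:
  assumes "(a, b) \<in> (Restr R X)\<^sup>*" "a \<in> X"
  obtains xs where "distinct xs" "xs \<noteq> []" "hd xs = a" "last xs = b"
    "successively (\<lambda>x y. (x, y) \<in> R) xs" "set xs \<subseteq> X"
proof -
  have "\<exists>xs. distinct xs \<and> xs \<noteq> [] \<and> hd xs = a \<and> last xs = b \<and>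
      successively (\<lambda>x y. (x, y) \<in> R) xs \<and> set xs \<subseteq> X"
    using assms(1)
  proof (induction rule: rtrancl_induct)
    case base
    then show ?case using assms(2) by (intro exI[of _ "[a]"]) auto
  next
    case (step b c)
    then obtain xs where xs: "distinct xs" "xs \<noteq> []" "hd xs = a" "last xs = b"
      "successively (\<lambda>x y. (x, y) \<in> R) xs" "set xs \<subseteq> X" by blast
    show ?case
    proof (cases "c \<in> set xs")
      case True
      \<comment> \<open>A revisited vertex closes a loop; the prefix up to its earlier occurrence is
        already a path to it.\<close>
      then obtain ys zs where "xs = ys @ c # zs" by (meson split_list)
      then have "xs = (ys @ [c]) @ zs" by simp
      then show ?thesis using xs
        by (intro exI[of _ "ys @ [c]"]) (auto simp: successively_append_iff hd_append)
    next
      case False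
      then show ?thesis using xs step(2)
        by (intro exI[of _ "xs @ [c]"]) (auto simp: successively_append_iff hd_append)
    qed
  qed
  then show thesis using that by blast
qed

lemma sym_rtrancl_Restr: "sym A \<Longrightarrow> (x, y) \<in> (Restr A X)\<^sup>* \<Longrightarrow> (y, x) \<in> (Restr A X)\<^sup>*"
  by (rule symD[OF sym_rtrancl]) (auto simp: sym_def)

text \<open>Vertex lists can be cut and spliced, unlike the edge sets in \<open>cycles\<close>. The
  length bound excludes an edge traversed back and forth.\<close>

definition is_cycle :: "'a rel \<Rightarrow> 'a list \<Rightarrow> bool" where
  "is_cycle A xs \<longleftrightarrow> distinct xs \<and> 3 \<le> length xs \<and> successively (\<lambda>x y. (x, y) \<in> A) xs \<and>
     (last xs, hd xs) \<in> A"

lemma is_cycle_rotate: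
  assumes "is_cycle A xs" "s \<in> set xs"
  obtains t where "is_cycle A (s # t)" "set (s # t) = set xs"
proof -
  obtain ys zs where "xs = ys @ s # zs" using assms(2) by (meson split_list)
  then have "is_cycle A (s # zs @ ys)" "set (s # zs @ ys) = set xs"
    using assms(1) unfolding is_cycle_def
    by (auto simp: successively_append_iff successively_Cons hd_append split: if_splits)
  then show thesis using that by blast
qed

section \<open>A vertex of small degree in the square\<close>

text \<open>\<open>cycles_agree\<close> is the cactus condition for the edge xy: any cycle through
  it can be listed starting with x, y. Comparing vertex sets is enough, because a chord or an ear
  yields a second cycle with a different vertex set.\<close>

locale cactus_rel =
  fixes V :: "'a set" and A :: "'a rel"
  assumes fin: "finite V"
    and sub: "A \<subseteq> V \<times> V"
    and sym: "sym A"
    and irr: "(x, x) \<notin> A"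
    and conn: "x \<in> V \<Longrightarrow> y \<in> V \<Longrightarrow> (x, y) \<in> A\<^sup>*"
    and cycles_agree: "is_cycle A (x # y # zs) \<Longrightarrow> is_cycle A (x # y # ws) \<Longrightarrow> set zs = set ws"
begin

abbreviation minus_vertex :: "'a \<Rightarrow> 'a rel" where
  "minus_vertex p \<equiv> Restr A (- {p})"

text \<open>For \<open>s \<noteq> p\<close> this is the component of G - p containing s; for
  \<open>s = p\<close> it degenerates to \<open>{p}\<close>, as no arc of
  \<open>minus_vertex p\<close> touches p.\<close>

definition branch :: "'a \<Rightarrow> 'a \<Rightarrow> 'a set" where
  "branch p s = {x. (s, x) \<in> (minus_vertex p)\<^sup>*}"

definition nbrs :: "'a \<Rightarrow> 'a set" where
  "nbrs p = {x. (p, x) \<in> A}"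

definition square_nbrs :: "'a \<Rightarrow> 'a set" where
  "square_nbrs v = {u. u \<noteq> v \<and> ((v, u) \<in> A \<or> (\<exists>w. (v, w) \<in> A \<and> (w, u) \<in> A))}"

section \<open>Chords and ears of cycles\<close>

lemma symA: "(x, y) \<in> A \<Longrightarrow> (y, x) \<in> A"
  using sym by (auto dest: symD)

text \<open>A chord from q to u would close off a shorter cycle along t up to u. It shares the edge
  from q to \<open>hd t\<close> with the whole cycle but misses \<open>last t\<close>, against
  \<open>cycles_agree\<close>.\<close>

lemma cycle_chordless:
  assumes "is_cycle A (q # t)" "u \<in> set t" "(q, u) \<in> A"
  shows "u = hd t \<or> u = last t"
proof (rule ccontr)
  assume neg: "\<not> ?thesis"
  obtain t1 t2 where t: "t = t1 @ u # t2" using assms(2) by (meson split_list)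
  obtain x t1' where t1: "t1 = x # t1'" using neg t by (cases t1) auto
  have "t2 \<noteq> []" using neg t by auto
  then have last: "last t \<in> set t2" using t by auto
  have "is_cycle A (q # x # t1' @ [u])"
    using assms(1) symA[OF assms(3)] unfolding is_cycle_def t t1
    by (auto simp: successively_append_iff successively_Cons hd_append split: if_splits)
  moreover have "is_cycle A (q # x # t1' @ u # t2)" using assms(1) t t1 by simp
  ultimately have "set (t1' @ [u]) = set (t1' @ u # t2)" by (rule cycles_agree)
  then have "last t \<in> set (t1' @ [u])" using last by simp
  moreover have "set t2 \<inter> set (t1' @ [u]) = {}"
    using assms(1) unfolding t t1 is_cycle_def by auto
  ultimately show False using last by blast
qed

text \<open>The ear is followed to its first return \<open>z'\<close> and joined to the stretch of C
  from q to \<open>z'\<close>. The resulting cycle has its first edge at q in common with C, yet it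
  contains y.\<close>

lemma no_ear:
  assumes cyc: "is_cycle A C" and y: "y \<notin> set C" and q: "q \<in> set C" "(q, y) \<in> A"
    and reach: "(y, z) \<in> (minus_vertex q)\<^sup>*" and z: "z \<in> set C" "z \<noteq> q"
  shows False
proof -
  obtain t where t: "is_cycle A (q # t)" "set (q # t) = set C"
    using is_cycle_rotate[OF cyc q(1)] .
  have "z \<in> set t" "y \<notin> set t" using t z y by auto
  then obtain y' z' where hit: "(y, y') \<in> (Restr (minus_vertex q) (- set t))\<^sup>*"
    "(y', z') \<in> minus_vertex q" "y' \<notin> set t" "z' \<in> set t"
    using rtrancl_first_hit[OF reach] by metis
  \<comment> \<open>Avoiding q and t is avoiding all of C, so the path \<open>ys\<close> is disjoint
    from C.\<close>
  have eq: "Restr (minus_vertex q) (- set t) = Restr A (- set (q # t))" by auto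
  have "y \<in> - set (q # t)" using y t(2) by simp
  then obtain ys where ys: "distinct ys" "ys \<noteq> []" "hd ys = y" "last ys = y'"
    "successively (\<lambda>x y. (x, y) \<in> A) ys" "set ys \<subseteq> - set (q # t)"
    using rtrancl_distinct_path[OF hit(1)[unfolded eq]] by blast
  obtain t1 t2 where t12: "t = t1 @ z' # t2" using hit(4) by (meson split_list)
  \<comment> \<open>The new cycle runs through the ear backwards, from \<open>z'\<close> to
    q.\<close>
  have rs: "successively (\<lambda>x y. (x, y) \<in> A) (rev ys)" "hd (rev ys) = y'" "last (rev ys) = y"
    using ys successively_mono[OF ys(5), of "\<lambda>x y. (y, x) \<in> A"] symA
    by (simp_all add: hd_rev last_rev)
  have "distinct (q # t1 @ z' # rev ys)"
    using t(1) ys(1,6) unfolding is_cycle_def t12 by auto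
  moreover have "3 \<le> length (q # t1 @ z' # rev ys)"
    using ys(2) by (cases ys) auto
  moreover have "successively (\<lambda>x y. (x, y) \<in> A) ((q # t1 @ [z']) @ rev ys)"
  proof -
    have "successively (\<lambda>x y. (x, y) \<in> A) ((q # t1 @ [z']) @ t2)"
      using t(1) unfolding is_cycle_def t12 by simp
    then have "successively (\<lambda>x y. (x, y) \<in> A) (q # t1 @ [z'])"
      unfolding successively_append_iff by blast
    moreover have "(z', y') \<in> A" using hit(2) symA by blast
    ultimately show ?thesis using rs unfolding successively_append_iff by simp
  qed
  moreover have "(last (rev ys), q) \<in> A" using rs(3) symA[OF q(2)] by simp
  ultimately have c: "is_cycle A (q # t1 @ z' # rev ys)"
    unfolding is_cycle_def using ys(2) by simp
  have "y \<in> set ys" using ys by (metis hd_in_set)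
  show False
  \<comment> \<open>The shared edge leads from q to \<open>z'\<close> if \<open>z'\<close> directly
    follows q on C, and to the head of \<open>t1\<close> otherwise.\<close>
  proof (cases t1)
    case Nil
    have "set (rev ys) = set t2"
      by (rule cycles_agree[of q z']) (use c t(1) t12 Nil in simp_all)
    then show ?thesis using \<open>y \<in> set ys\<close> \<open>y \<notin> set t\<close> t12 by auto
  next
    case (Cons x t1')
    have "set (t1' @ z' # rev ys) = set (t1' @ z' # t2)"
      by (rule cycles_agree[of q x]) (use c t(1) t12 Cons in simp_all)
    then show ?thesis using \<open>y \<in> set ys\<close> \<open>y \<notin> set t\<close> t12 Cons by auto
  qed
qed

lemma cycle_nbrs_le_2:
  assumes "is_cycle A C" "q \<in> set C"
  shows "card (nbrs q \<inter> set C) \<le> 2"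
proof -
  obtain t where t: "is_cycle A (q # t)" "set (q # t) = set C"
    using is_cycle_rotate[OF assms] .
  have "nbrs q \<inter> set C \<subseteq> {hd t, last t}"
    using cycle_chordless[OF t(1)] irr unfolding nbrs_def t(2)[symmetric] by auto
  then have "card (nbrs q \<inter> set C) \<le> card {hd t, last t}" by (rule card_mono[rotated]) auto
  also have "\<dots> \<le> 2" by (simp add: card_insert_if)
  finally show ?thesis .
qed

text \<open>Each of the at most two cycle neighbours w of s contributes itself and at most one more
  vertex, since s is among the at most two cycle neighbours of w.\<close>

lemma cycle_square_nbrs_le_4:
  assumes cyc: "is_cycle A C" and s: "s \<in> set C"
  shows "card (\<Union>w\<in>nbrs s \<inter> set C. insert w (nbrs w \<inter> set C - {s})) \<le> 4"
proof -
  have each: "card (insert w (nbrs w \<inter> set C - {s})) \<le> 2" if "w \<in> nbrs s \<inter> set C" for w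
  proof -
    have "s \<in> nbrs w \<inter> set C" using that s symA unfolding nbrs_def by blast
    then have "card (nbrs w \<inter> set C - {s}) \<le> 1"
      using cycle_nbrs_le_2[OF cyc, of w] that by (simp add: card_Diff_singleton)
    then show ?thesis using card_insert_le_m1 by (simp add: card_insert_if)
  qed
  have "card (\<Union>w\<in>nbrs s \<inter> set C. insert w (nbrs w \<inter> set C - {s}))
      \<le> (\<Sum>w\<in>nbrs s \<inter> set C. card (insert w (nbrs w \<inter> set C - {s})))"
    by (rule card_UN_le) auto
  also have "\<dots> \<le> (\<Sum>w\<in>nbrs s \<inter> set C. 2)" by (rule sum_mono) (use each in auto)
  also have "\<dots> \<le> 4" using cycle_nbrs_le_2[OF cyc s] by simp
  finally show ?thesis .
qed

section \<open>Branches at a deleted vertex\<close>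

lemma branch_cases:
  assumes "x \<in> branch p s"
  shows "x = s \<or> x \<noteq> p \<and> x \<in> V"
proof (cases "x = s")
  case False
  moreover have "(s, x) \<in> (minus_vertex p)\<^sup>*" using assms by (simp add: branch_def)
  ultimately obtain y where "(y, x) \<in> minus_vertex p" by (metis rtranclE)
  then show ?thesis using sub by blast
qed simp

lemma finite_branch: "finite (branch p s)"
  using branch_cases[of _ p s] finite_subset[of "branch p s" "insert s V"] fin by auto

lemma branch_step: "x \<in> branch p s \<Longrightarrow> (x, y) \<in> A \<Longrightarrow> x \<noteq> p \<Longrightarrow> y \<noteq> p \<Longrightarrow> y \<in> branch p s"
  unfolding branch_def mem_Collect_eq by (erule rtrancl_into_rtrancl) auto

lemma branch_avoids: "s \<noteq> p \<Longrightarrow> x \<in> branch p s \<Longrightarrow> x \<noteq> p"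
  using branch_cases by blast

lemma branch_connected:
  "x \<in> branch p s \<Longrightarrow> y \<in> branch p s \<Longrightarrow> (x, y) \<in> (minus_vertex p)\<^sup>*"
  unfolding branch_def mem_Collect_eq by (rule rtrancl_trans[OF sym_rtrancl_Restr[OF sym]])

text \<open>A walk from t in G - q never meets p, hence it stays in the component of G - p; the
  inclusion is strict because q is lost. This is what contradicts the minimal choice of a
  branch.\<close>

lemma branch_psubset:
  assumes "s \<noteq> p" "q \<in> branch p s" "t \<in> branch p s" "t \<noteq> q" "p \<notin> branch q t"
  shows "branch q t \<subset> branch p s"
proof -
  have "x \<in> branch p s" if "(t, x) \<in> (minus_vertex q)\<^sup>*" for x
    using that
  proof (induction rule: rtrancl_induct)
    case base
    then show ?case using assms(3) .
  next
    case (step y z)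
    then have "z \<in> branch q t" unfolding branch_def mem_Collect_eq by (metis rtrancl_into_rtrancl)
    then have "z \<noteq> p" using assms(5) by auto
    moreover have "y \<noteq> p" using branch_avoids[OF assms(1) step(3)] .
    ultimately show ?case using step branch_step by auto
  qed
  moreover have "q \<notin> branch q t" using branch_avoids assms(4) by blast
  ultimately show ?thesis using assms(2) unfolding branch_def[of q t] by auto
qed

text \<open>The vertex just before the first visit to p is as required. The set X allows two uses:
  \<open>UNIV\<close> gives one neighbour a of p, and \<open>- {a}\<close> a second one.\<close>

lemma branch_has_nbr:
  assumes "(s, p) \<in> (Restr A X)\<^sup>*" "s \<noteq> p"
  obtains a where "a \<in> nbrs p" "a \<in> branch p s" "(s, a) \<in> (Restr A X)\<^sup>*" "a \<in> X"
proof -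
  obtain y where yx: "(s, y) \<in> (Restr (Restr A X) (- {p}))\<^sup>*" "(y, p) \<in> Restr A X"
    by (rule rtrancl_first_hit[OF assms(1), of "{p}"]) (use assms(2) in blast)+
  have "Restr (Restr A X) (- {p}) \<subseteq> minus_vertex p" "Restr (Restr A X) (- {p}) \<subseteq> Restr A X"
    by auto
  then have "(s, y) \<in> (minus_vertex p)\<^sup>*" "(s, y) \<in> (Restr A X)\<^sup>*"
    using yx(1) rtrancl_mono by blast+
  then show thesis using yx that[of y] symA[of y p] unfolding nbrs_def branch_def by blast
qed

text \<open>A walk of at most two steps from v either passes through p, and then ends next to p, or
  it ends in the branch or at p. Trading v for p keeps the bound at the degree of p.\<close>

lemma square_nbrs_branch:
  assumes "v \<in> branch p s" "s \<noteq> p" "v \<in> nbrs p" "S \<inter> branch p s \<subseteq> nbrs p"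
  shows "S \<inter> square_nbrs v \<subseteq> insert p (nbrs p - {v})"
proof
  fix u assume u: "u \<in> S \<inter> square_nbrs v"
  have vp: "v \<noteq> p" using assms(1,2) branch_avoids by blast
  have uv: "u \<noteq> v" using u by (auto simp: square_nbrs_def)
  have inb: "u \<in> nbrs p \<or> u = p" if "w \<in> branch p s" "(w, u) \<in> A" for w
    using branch_step[OF that] branch_avoids[OF assms(2) that(1)] u assms(4) by auto
  consider "(v, u) \<in> A" | w where "(v, w) \<in> A" "(w, u) \<in> A"
    using u by (auto simp: square_nbrs_def)
  then show "u \<in> insert p (nbrs p - {v})"
  proof cases
    case 1
    then show ?thesis using inb[OF assms(1)] uv by auto
  next
    case (2 w)
    show ?thesis
    proof (cases "w = p")
      case True
      then show ?thesis using 2 uv by (auto simp: nbrs_def)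
    next
      case False
      then show ?thesis using inb[OF branch_step[OF assms(1) 2(1) vp]] 2 uv by auto
    qed
  qed
qed

section \<open>A vertex of S with few square neighbours in S\<close>

lemma exists_low_square_degree:
  assumes S: "S \<subseteq> V" "S \<noteq> {}" and D: "\<And>p. p \<in> V \<Longrightarrow> card (nbrs p) \<le> D" "4 \<le> D"
  shows "\<exists>v\<in>S. card (S \<inter> square_nbrs v) \<le> D"
proof (cases "\<exists>p s. p \<in> V \<and> s \<in> S \<and> s \<noteq> p")
  case False
  \<comment> \<open>The graph then has only one vertex.\<close>
  then obtain s where "S = {s}" using S by blast
  then show ?thesis by (intro bexI[of _ s]) (auto simp: square_nbrs_def)
next
  case True
  define P where "P = (\<lambda>(p, s). p \<in> V \<and> s \<in> S \<and> s \<noteq> p)"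
  define m where "m = (\<lambda>(p, s). card (branch p s))"
  have "\<exists>x. P x" using True by (auto simp: P_def)
  then obtain x where x: "P x" "\<And>y. P y \<Longrightarrow> m x \<le> m y"
    using exists_least_iff[of "\<lambda>n. \<exists>x. P x \<and> m x = n"] by (metis not_le)
  obtain p s0 where [simp]: "x = (p, s0)" by (cases x)
  define K where "K = branch p s0"
  have p: "p \<in> V" "s0 \<in> S" "s0 \<noteq> p" using x(1) by (auto simp: P_def)
  have s0K: "s0 \<in> K" by (simp add: K_def branch_def)
  have KV: "K \<subseteq> V"
    using p S branch_cases unfolding K_def by blast
  have pK: "x \<noteq> p" if "x \<in> K" for x using that branch_avoids p unfolding K_def by blast
  have stepK: "y \<in> K" if "x \<in> K" "(x, y) \<in> A" "y \<noteq> p" for x y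
    using branch_step that pK unfolding K_def by blast
  \<comment> \<open>Otherwise the component of t in G - q would be a strictly smaller branch meeting S.\<close>
  have reach: "(t, p) \<in> (minus_vertex q)\<^sup>*" if "q \<in> K" "t \<in> K" "t \<in> S" "t \<noteq> q" for q t
  proof (rule ccontr)
    assume "\<not> ?thesis"
    then have "p \<notin> branch q t" by (simp add: branch_def)
    then have "branch q t \<subset> branch p s0"
      using branch_psubset[OF p(3)] that unfolding K_def by blast
    then have "m (q, t) < m x"
      unfolding m_def using finite_branch by (auto intro: psubset_card_mono)
    then show False using x(2)[of "(q, t)"] that KV by (auto simp: P_def)
  qed
  show ?thesis
  proof (cases "S \<inter> K \<subseteq> nbrs p")
    case True
    then have "s0 \<in> nbrs p" using s0K p by auto
    have fn: "finite (nbrs p)" using sub fin by (auto simp: nbrs_def intro: finite_subset)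
    have "S \<inter> square_nbrs s0 \<subseteq> insert p (nbrs p - {s0})"
      using square_nbrs_branch[of s0 p s0 S] True \<open>s0 \<in> nbrs p\<close> s0K p unfolding K_def by auto
    then have "card (S \<inter> square_nbrs s0) \<le> card (insert p (nbrs p - {s0}))"
      using fn by (intro card_mono) auto
    also have "\<dots> \<le> Suc (card (nbrs p - {s0}))" by (rule card_insert_le_m1) auto
    also have "\<dots> = card (nbrs p)" using \<open>s0 \<in> nbrs p\<close> fn by (rule card_Suc_Diff1[rotated])
    finally show ?thesis using D p by (meson le_trans)
  next
    case False
    then obtain s where s: "s \<in> S" "s \<in> K" "s \<notin> nbrs p" by auto
    have sp: "s \<noteq> p" using s pK by auto
    \<comment> \<open>By symmetry the component can be re-rooted at s.\<close>
    have K_eq: "K = branch p s"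
      using s(2) branch_connected unfolding K_def
      by (metis (no_types, lifting) Collect_cong branch_def mem_Collect_eq rtrancl_trans s0K K_def)
    obtain a where a: "a \<in> nbrs p" "a \<in> K"
      using branch_has_nbr[of s p UNIV] conn[of s p] s S p sp K_eq by auto
    \<comment> \<open>Here \<open>a \<noteq> s\<close>, since s is not adjacent to p. Deleting a
      does not cut s off from p, so p has a second neighbour b in K.\<close>
    have "(s, p) \<in> (minus_vertex a)\<^sup>*" using reach[of a s] a s by auto
    then obtain b where b: "b \<in> nbrs p" "b \<in> K" "b \<noteq> a"
      using branch_has_nbr[of s p "- {a}"] sp K_eq by auto
    \<comment> \<open>A path from a to b in G - p, which p closes to a cycle because a and b
      differ.\<close>
    obtain xs where xs: "distinct xs" "xs \<noteq> []" "hd xs = a" "last xs = b"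
      "successively (\<lambda>x y. (x, y) \<in> A) xs" "set xs \<subseteq> - {p}"
      using rtrancl_distinct_path[of a b A "- {p}"] branch_connected[of a p s0 b] a b pK
      unfolding K_def by auto
    have "2 \<le> length xs" using xs b(3) by (cases xs; cases "tl xs") auto
    then have C: "is_cycle A (p # xs)"
      using xs a b symA[of p b] unfolding is_cycle_def nbrs_def by (auto simp: successively_Cons)
    have aC: "a \<in> set xs" using xs by auto
    \<comment> \<open>No excursion leaves the cycle at q and reaches t: by \<open>reach\<close>, t
      is joined to p without q, so the excursion would extend to an ear ending at p.\<close>
    have no_esc: False
      if "q \<in> set xs" "q \<in> K" "y \<notin> set (p # xs)" "(q, y) \<in> A" "t \<in> S" "t \<noteq> q"
        "(y, t) \<in> (minus_vertex q)\<^sup>*" "t \<in> K" for q y t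
      using no_ear[OF C that(3) _ that(4), of p] reach[of q t] that pK
      by (auto intro: rtrancl_trans)
    have s_on: "s \<in> set xs"
    proof (rule ccontr)
      assume nin: "s \<notin> set xs"
      have "(s, a) \<in> (minus_vertex p)\<^sup>*" using branch_connected s a unfolding K_def by blast
      \<comment> \<open>The walk from s to a first meets the cycle at q, coming from y; read
        backwards it is an excursion from q to s.\<close>
      then obtain y q where yq: "(s, y) \<in> (Restr (minus_vertex p) (- set xs))\<^sup>*"
        "(y, q) \<in> minus_vertex p" "y \<notin> set xs" "q \<in> set xs"
        using rtrancl_first_hit[of s a "minus_vertex p" "set xs"] nin aC by metis
      have "(s, y) \<in> (minus_vertex p)\<^sup>*"
        using yq(1) rtrancl_mono[of "Restr (minus_vertex p) (- set xs)" "minus_vertex p"] by auto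
      then have "y \<in> K" unfolding K_eq branch_def by simp
      then have "q \<in> K" using stepK yq by auto
      have "(s, y) \<in> (minus_vertex q)\<^sup>*"
        using yq(1,4) rtrancl_mono[of "Restr (minus_vertex p) (- set xs)" "minus_vertex q"] by auto
      then show False
        using no_esc[of q y s] yq \<open>q \<in> K\<close> s nin pK \<open>y \<in> K\<close> symA[of y q] sym_rtrancl_Restr[OF sym, of s y]
        by auto
    qed
    have "S \<inter> square_nbrs s \<subseteq>
      (\<Union>w\<in>nbrs s \<inter> set (p # xs). insert w (nbrs w \<inter> set (p # xs) - {s}))"
    proof
      fix u assume u: "u \<in> S \<inter> square_nbrs s"
      then have us: "u \<in> S" "u \<noteq> s" by (auto simp: square_nbrs_def)
      consider "(s, u) \<in> A" | w where "(s, w) \<in> A" "(w, u) \<in> A"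
        using u by (auto simp: square_nbrs_def)
      then show "u \<in> (\<Union>w\<in>nbrs s \<inter> set (p # xs). insert w (nbrs w \<inter> set (p # xs) - {s}))"
      proof cases
        case 1
        have "u \<in> set (p # xs)"
        proof (rule ccontr)
          assume n: "u \<notin> set (p # xs)"
          then have "u \<in> K" using stepK[OF s(2) 1] by auto
          \<comment> \<open>The excursion is a single edge: u is both its first vertex and its
            target.\<close>
          then show False using no_esc[of s u u] 1 n us s s_on by auto
        qed
        then show ?thesis using 1 by (auto simp: nbrs_def)
      next
        case (2 w)
        have wp: "w \<noteq> p" using 2 s(3) symA[of s p] by (auto simp: nbrs_def)
        have wK: "w \<in> K" using stepK 2 s wp by blast
        have ws: "w \<noteq> s" using 2 irr by auto
        have wu: "(w, u) \<in> minus_vertex s" using 2 us ws by auto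
        have uK: "u \<in> K" if "u \<notin> set (p # xs)" using stepK[OF wK 2(2)] that by auto
        \<comment> \<open>Off the cycle, w would start an ear at s if u lies on the cycle, and an
          excursion from s to u otherwise.\<close>
        have wC: "w \<in> set xs"
        proof (rule ccontr)
          assume n: "w \<notin> set xs"
          show False
          proof (cases "u \<in> set (p # xs)")
            case True
            then show False using no_ear[OF C, of w s u] n wp s_on 2 wu us by auto
          next
            case False
            then show False using no_esc[of s w u] n wp s_on 2 wu us s uK by auto
          qed
        qed
        have "u \<in> set (p # xs)"
        proof (rule ccontr)
          assume n: "u \<notin> set (p # xs)"
          have "u \<noteq> w" using 2 irr by auto
          then show False using no_esc[of w u u] 2 n us wK wC uK by auto
        qed
        then show ?thesis using 2 wC us by (auto simp: nbrs_def)
      qed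
    qed
    then have "card (S \<inter> square_nbrs s) \<le>
      card (\<Union>w\<in>nbrs s \<inter> set (p # xs). insert w (nbrs w \<inter> set (p # xs) - {s}))"
      by (intro card_mono) auto
    also have "\<dots> \<le> 4" using cycle_square_nbrs_le_4[OF C] s_on by simp
    finally show ?thesis using D(2) s by (meson le_trans)
  qed
qed

end

section \<open>Transfer to digraphs and list colouring\<close>

lemma awalk_of_vertex_list:
  assumes "pair_wf_digraph G" "x \<in> pverts G" "successively (\<lambda>x y. (x, y) \<in> parcs G) (x # xs)"
  shows "pre_digraph.awalk (with_proj G) x (zip (x # xs) xs) (last (x # xs)) \<and>
    pre_digraph.awalk_verts (with_proj G) x (zip (x # xs) xs) = x # xs"
proof -
  interpret pair_wf_digraph G by fact
  show ?thesis using assms(2,3)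
  proof (induction xs arbitrary: x)
    case Nil
    then show ?case by (simp add: awalk_Nil_iff)
  next
    case (Cons y xs)
    then have "y \<in> pverts G" by (auto dest: in_arcsD2)
    then show ?case using Cons by (auto simp: awalk_Cons_iff)
  qed
qed

text \<open>For nonempty \<open>xs\<close> the first list is longer by one and \<open>zip\<close>
  drops its last entry; this is the shape used in \<open>awalk_of_vertex_list\<close>.\<close>

definition cycle_arcs :: "'a list \<Rightarrow> ('a \<times> 'a) list" where
  "cycle_arcs xs = zip (xs @ [hd xs]) (tl xs @ [hd xs])"

lemma cycle_arcs_in_cycles:
  assumes "pair_wf_digraph G" "is_cycle (parcs G) xs"
  shows "edges_of (set (cycle_arcs xs)) \<in> cycles G"
proof -
  interpret pair_wf_digraph G by fact
  obtain x ys where xs: "xs = x # ys" using assms(2) by (cases xs) (auto simp: is_cycle_def)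
  have suc: "successively (\<lambda>x y. (x, y) \<in> parcs G) (x # ys @ [x])"
    using assms(2) xs unfolding is_cycle_def
    by (auto simp: successively_append_iff successively_Cons split: if_splits)
  have "x \<in> pverts G" using assms(2) xs unfolding is_cycle_def by (auto dest: in_arcsD2)
  note w = awalk_of_vertex_list[OF assms(1) this suc]
  have "cycle (cycle_arcs xs)"
    using w assms(2) unfolding cycle_def cycle_arcs_def xs is_cycle_def
    by (intro exI[of _ x]) auto
  moreover have "3 \<le> length (cycle_arcs xs)"
    using assms(2) xs unfolding cycle_arcs_def is_cycle_def by auto
  ultimately show ?thesis unfolding cycles_def by auto
qed

text \<open>Links the edge sets compared in \<open>cactus\<close> to the vertex sets compared in
  \<open>cycles_agree\<close>.\<close>

lemma Union_edges_cycle_arcs: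
  assumes "xs \<noteq> []" shows "\<Union> (edges_of (set (cycle_arcs xs))) = set xs"
proof -
  obtain x ys where xs: "xs = x # ys" using assms by (cases xs) auto
  have l: "length (xs @ [hd xs]) = Suc (length (tl xs @ [hd xs]))" by (simp add: xs)
  have "\<Union> (edges_of (set ps)) = fst ` set ps \<union> snd ` set ps" for ps :: "('a \<times> 'a) list"
    unfolding edges_of_def by force
  moreover have "set (map fst (cycle_arcs xs)) = set xs"
    using l unfolding cycle_arcs_def by (simp add: zip_append1 map_fst_zip_take xs)
  moreover have "set (map snd (cycle_arcs xs)) = set xs"
    using l unfolding cycle_arcs_def by (simp add: map_snd_zip_take xs)
  ultimately show ?thesis by (metis list.set_map Un_absorb)
qed

text \<open>Both cycles contain the edge xy, so their edge sets coincide, hence also their vertex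
  sets; x and y cancel by distinctness.\<close>

lemma cactus_cycles_agree:
  assumes "cactus G" "is_cycle (parcs G) (x # y # zs)" "is_cycle (parcs G) (x # y # ws)"
  shows "set zs = set ws"
proof -
  interpret pair_graph G using assms(1) by (simp add: cactus_def)
  have wf: "pair_wf_digraph G" by (rule pair_wf_digraph)
  have xy: "{x, y} \<in> edges_of (parcs G)"
    using assms(2) unfolding is_cycle_def edges_of_def by force
  have e: "{x, y} \<in> edges_of (set (cycle_arcs (x # y # vs)))" for vs
    unfolding edges_of_def cycle_arcs_def by force
  have "edges_of (set (cycle_arcs (x # y # zs))) = edges_of (set (cycle_arcs (x # y # ws)))"
    using assms(1) xy e cycle_arcs_in_cycles[OF wf assms(2)] cycle_arcs_in_cycles[OF wf assms(3)]
    unfolding cactus_def Uniq_def by blast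
  then have "set (x # y # zs) = set (x # y # ws)"
    by (metis Union_edges_cycle_arcs list.distinct(1))
  then show ?thesis using assms(2,3) unfolding is_cycle_def by auto
qed

lemma cactus_rel_cactus:
  assumes "cactus G"
  shows "cactus_rel (pverts G) (parcs G)"
proof -
  interpret pair_graph G using assms by (simp add: cactus_def)
  have con: "connected (with_proj G)" using assms by (simp add: cactus_def)
  show ?thesis
  proof
    show "finite (pverts G)" by (rule pair_finite_verts)
    show "parcs G \<subseteq> pverts G \<times> pverts G" using in_arcsD1 in_arcsD2 by auto
    show "sym (parcs G)" using arcs_symmetric by (auto intro: symI)
    show "(x, x) \<notin> parcs G" for x using no_loops' by auto
    show "(x, y) \<in> (parcs G)\<^sup>*" if "x \<in> pverts G" "y \<in> pverts G" for x y
    proof -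
      have "strongly_connected (with_proj G)"
        using symmetric_connected_imp_strongly_connected con sym_arcs by auto
      then have "x \<rightarrow>\<^sup>*\<^bsub>with_proj G\<^esub> y" using that by (auto simp: strongly_connected_def)
      then show ?thesis by (simp add: reachable_def rtrancl_on_rtranclI)
    qed
    show "set zs = set ws"
      if "is_cycle (parcs G) (x # y # zs)" "is_cycle (parcs G) (x # y # ws)" for x y zs ws
      using cactus_cycles_agree[OF assms that] .
  qed
qed

section \<open>Distance at most two and the square\<close>

lemma parcs_graph_square:
  assumes "pair_wf_digraph G"
  shows "(u, v) \<in> parcs (graph_square G) \<longleftrightarrow> u \<in> pverts G \<and> v \<in> pverts G \<and> u \<noteq> v \<and>
    ((u, v) \<in> parcs G \<or> (\<exists>w. (u, w) \<in> parcs G \<and> (w, v) \<in> parcs G))"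
proof -
  interpret pair_wf_digraph G by fact
  have cost: "awalk_cost (\<lambda>_. 1) p = real (length p)" for p :: "('a \<times> 'a) list"
    by (induction p) auto
  \<comment> \<open>With unit arc costs the distance is the infimum of the walk lengths.\<close>
  have d: "graph_dist G u v = (INF p\<in>{p. awalk u p v}. ereal (real (length p)))"
    unfolding graph_dist_def \<mu>_def cost ..
  have ge1: "1 \<le> graph_dist G u v \<longleftrightarrow> u \<noteq> v" if "u \<in> pverts G"
  proof
    assume "1 \<le> graph_dist G u v"
    then have "1 \<le> ereal (real (length p))" if "awalk u p v" for p
      using that unfolding d le_INF_iff by auto
    from this[of "[]"] show "u \<noteq> v" using \<open>u \<in> pverts G\<close> by (auto simp: awalk_Nil_iff)
  next
    assume "u \<noteq> v"
    then have "1 \<le> length p" if "awalk u p v" for p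
      using that by (cases p) (auto simp: awalk_Nil_iff)
    then show "1 \<le> graph_dist G u v"
      unfolding d le_INF_iff by (auto simp: one_ereal_def)
  qed
  have le2: "graph_dist G u v \<le> 2 \<longleftrightarrow> (\<exists>p. awalk u p v \<and> length p \<le> 2)"
  proof
    assume "graph_dist G u v \<le> 2"
    \<comment> \<open>A strict bound on the infimum yields a walk below that bound, and an integer
      length below 3 is at most 2.\<close>
    then have "graph_dist G u v < ereal 3" by (rule order_le_less_trans) simp
    then obtain p where "awalk u p v" "ereal (real (length p)) < ereal 3"
      unfolding d INF_less_iff by blast
    then show "\<exists>p. awalk u p v \<and> length p \<le> 2"
      by (intro exI[of _ p]) simp
  next
    assume "\<exists>p. awalk u p v \<and> length p \<le> 2"
    then obtain p where p: "awalk u p v" "length p \<le> 2" by auto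
    have "graph_dist G u v \<le> ereal (real (length p))"
      unfolding d using p by (intro INF_lower) auto
    also have "\<dots> \<le> ereal 2" using p by simp
    also have "ereal 2 = 2" by simp
    finally show "graph_dist G u v \<le> 2" .
  qed
  have "(\<exists>p. awalk u p v \<and> length p \<le> 2) \<longleftrightarrow>
    ((u, v) \<in> parcs G \<or> (\<exists>w. (u, w) \<in> parcs G \<and> (w, v) \<in> parcs G))"
    if "u \<in> pverts G" "v \<in> pverts G" "u \<noteq> v"
  proof
    assume "\<exists>p. awalk u p v \<and> length p \<le> 2"
    then obtain p where p: "awalk u p v" "length p \<le> 2" by auto
    consider "p = []" | e where "p = [e]" | e f where "p = [e, f]"
      using p(2) by (cases p; cases "tl p") auto
    then show "(u, v) \<in> parcs G \<or> (\<exists>w. (u, w) \<in> parcs G \<and> (w, v) \<in> parcs G)"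
      by cases (use p(1) that in \<open>auto simp: awalk_Nil_iff awalk_Cons_iff\<close>)
  next
    assume "(u, v) \<in> parcs G \<or> (\<exists>w. (u, w) \<in> parcs G \<and> (w, v) \<in> parcs G)"
    then show "\<exists>p. awalk u p v \<and> length p \<le> 2"
    proof
      assume "(u, v) \<in> parcs G"
      then show ?thesis using that
        by (intro exI[of _ "[(u, v)]"]) (auto simp: awalk_Nil_iff awalk_Cons_iff)
    next
      assume "\<exists>w. (u, w) \<in> parcs G \<and> (w, v) \<in> parcs G"
      then obtain w where "(u, w) \<in> parcs G" "(w, v) \<in> parcs G" by blast
      then show ?thesis using that
        by (intro exI[of _ "[(u, w), (w, v)]"])
          (auto simp: awalk_Nil_iff awalk_Cons_iff dest: in_arcsD2)
    qed
  qed
  then show ?thesis using ge1 le2 by (auto simp: graph_square_def)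
qed

lemma pair_graph_square:
  assumes "pair_graph G"
  shows "pair_graph (graph_square G)"
proof -
  interpret pair_graph G by fact
  note sq = parcs_graph_square[OF pair_wf_digraph]
  have v: "pverts (graph_square G) = pverts G" by (simp add: graph_square_def)
  have sub: "parcs (graph_square G) \<subseteq> pverts G \<times> pverts G" by (auto simp: graph_square_def)
  then have fin: "finite (parcs (graph_square G))"
    using pair_finite_verts by (meson finite_SigmaI finite_subset)
  have sym: "sym (parcs (graph_square G))"
    by (rule symI) (use arcs_symmetric in \<open>unfold sq, blast\<close>)
  show ?thesis
  proof
    show "symmetric (with_proj (graph_square G))"
      using sym by (simp add: symmetric_def)
    show "fst e \<noteq> snd e" if "e \<in> parcs (graph_square G)" for e
      using that by (cases e) (simp add: sq)
  qed (use sub fin pair_finite_verts v in auto)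
qed

section \<open>Degeneracy and list colouring\<close>

lemma out_degree_eq_card_nbrs:
  "out_degree (with_proj G) v = card {u. (v, u) \<in> parcs G}"
proof -
  have "out_arcs (with_proj G) v = Pair v ` {u. (v, u) \<in> parcs G}"
    by (auto simp: out_arcs_def)
  then show ?thesis unfolding out_degree_def by (simp add: card_image inj_on_def)
qed

text \<open>Induction on vertex sets S: the subgraph induced on S has a vertex v of degree at most
  d. Once \<open>S - {v}\<close> is coloured, at most d of the d + 1 or more colours in the list of
  v are forbidden.\<close>

lemma degenerate_imp_choosable:
  assumes "pair_graph H" "degenerate d H"
  shows "choosable H (d + 1)"
  unfolding choosable_def
proof (intro allI impI)
  fix L :: "'a \<Rightarrow> nat set"
  assume L: "\<forall>v\<in>pverts H. finite (L v) \<and> d + 1 \<le> card (L v)"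
  interpret pair_graph H by fact
  have "\<exists>c. (\<forall>v\<in>S. c v \<in> L v) \<and> (\<forall>u\<in>S. \<forall>v\<in>S. (u, v) \<in> parcs H \<longrightarrow> c u \<noteq> c v)"
    if "finite S" "S \<subseteq> pverts H" for S
    using that
  proof (induction S rule: finite_psubset_induct)
    case (psubset S)
    show ?case
    proof (cases "S = {}")
      case False
      define H' where "H' = \<lparr> pverts = S, parcs = Restr (parcs H) S \<rparr>"
      have "pair_graph H'"
      proof
        show "symmetric (with_proj H')"
          unfolding symmetric_def H'_def using arcs_symmetric by (auto intro!: symI)
      qed (use psubset pair_finite_arcs no_loops' in \<open>auto simp: H'_def\<close>)
      then interpret H': pair_graph H' .
      have S_eq: "pverts H' = S" by (simp add: H'_def)
      have "subgraph (with_proj H') (with_proj H)"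
        using psubset.prems H'.wf_digraph wf_digraph
        by (auto simp: subgraph_def compatible_def H'_def)
      then obtain v where v: "v \<in> S" "out_degree (with_proj H') v \<le> d"
        using assms(2) \<open>pair_graph H'\<close> False S_eq unfolding degenerate_def by metis
      define N where "N = {u. (v, u) \<in> parcs H'}"
      have N: "card N \<le> d" using v(2) by (simp add: out_degree_eq_card_nbrs N_def)
      have finN: "finite N" using psubset(1) by (auto simp: N_def H'_def intro: finite_subset)
      obtain c where c: "\<forall>u\<in>S - {v}. c u \<in> L u"
        "\<forall>u\<in>S - {v}. \<forall>w\<in>S - {v}. (u, w) \<in> parcs H \<longrightarrow> c u \<noteq> c w"
        using psubset.IH[of "S - {v}"] psubset.prems v(1) by blast
      have "card (c ` N) < card (L v)"
        using card_image_le[OF finN, of c] N L v(1) psubset.prems by fastforce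
      then have "\<not> L v \<subseteq> c ` N" using card_mono[of "c ` N" "L v"] finN by auto
      then obtain k where k: "k \<in> L v" "k \<notin> c ` N" by blast
      have new: "\<forall>u\<in>S. (v, u) \<in> parcs H \<longrightarrow> c u \<noteq> k" "\<forall>u\<in>S. (u, v) \<in> parcs H \<longrightarrow> c u \<noteq> k"
        using k v(1) arcs_symmetric by (auto simp: N_def H'_def)
      show ?thesis
      proof (intro exI[of _ "c(v := k)"] conjI ballI impI)
        show "(c(v := k)) u \<in> L u" if "u \<in> S" for u using c(1) k(1) that by simp
        show "(c(v := k)) u \<noteq> (c(v := k)) w" if "u \<in> S" "w \<in> S" "(u, w) \<in> parcs H" for u w
        proof (cases "u = v \<or> w = v")
          case True
          then show ?thesis using new that no_loops'[OF that(3)] by fastforce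
        next
          case False
          then show ?thesis using c(2) that by simp
        qed
      qed
    qed simp
  qed
  from this[OF pair_finite_verts order_refl]
  obtain c where "\<forall>v\<in>pverts H. c v \<in> L v"
    "\<forall>u\<in>pverts H. \<forall>v\<in>pverts H. (u, v) \<in> parcs H \<longrightarrow> c u \<noteq> c v"
    by blast
  then show "\<exists>c. (\<forall>v\<in>pverts H. c v \<in> L v) \<and> (\<forall>(u, v)\<in>parcs H. c u \<noteq> c v)"
    using in_arcsD1 in_arcsD2 by (intro exI[of _ c]) blast
qed

theorem theorem3:
  fixes G :: "'a pair_pre_digraph"
  assumes "cactus G"
  shows "degenerate (max (max_degree G) 4) (graph_square G) \<and>
    (4 \<le> max_degree G \<longrightarrow> choice_number (graph_square G) \<le> max_degree G + 1) \<and>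
    (max_degree G \<le> 3 \<longrightarrow> choice_number (graph_square G) \<le> 5)"
proof -
  interpret pair_graph G using assms by (simp add: cactus_def)
  interpret C: cactus_rel "pverts G" "parcs G" using cactus_rel_cactus[OF assms] .
  let ?D = "max (max_degree G) 4"
  have deg: "card (C.nbrs p) \<le> ?D" if "p \<in> pverts G" for p
  proof -
    have "out_degree (with_proj G) p \<le> max_degree G"
      unfolding max_degree_def using that pair_finite_verts by (intro Max_ge) auto
    then show ?thesis unfolding out_degree_eq_card_nbrs C.nbrs_def by simp
  qed
  have degen: "degenerate ?D (graph_square G)"
    unfolding degenerate_def
  proof (intro allI impI, elim conjE)
    fix H' assume H': "pair_graph H'" "subgraph (with_proj H') (with_proj (graph_square G))"
      "pverts H' \<noteq> {}"
    interpret H': pair_graph H' by fact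
    have S: "pverts H' \<subseteq> pverts G" and arcs: "parcs H' \<subseteq> parcs (graph_square G)"
      using H'(2) by (auto simp: subgraph_def graph_square_def)
    obtain v where v: "v \<in> pverts H'" "card (pverts H' \<inter> C.square_nbrs v) \<le> ?D"
      using C.exists_low_square_degree[OF S H'(3) deg] by auto
    \<comment> \<open>Only an inclusion, as \<open>H'\<close> may omit edges of the square between
      its vertices.\<close>
    have "{u. (v, u) \<in> parcs H'} \<subseteq> pverts H' \<inter> C.square_nbrs v"
      using arcs H'.in_arcsD2 parcs_graph_square[OF pair_wf_digraph, of v]
      unfolding C.square_nbrs_def by blast
    then have "out_degree (with_proj H') v \<le> ?D"
      unfolding out_degree_eq_card_nbrs
      using v(2) H'.pair_finite_verts by (meson card_mono finite_Int le_trans)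
    then show "\<exists>v\<in>pverts H'. out_degree (with_proj H') v \<le> ?D" using v(1) by blast
  qed
  then have "choosable (graph_square G) (?D + 1)"
    using degenerate_imp_choosable pair_graph_square pair_graph by blast
  then have "choice_number (graph_square G) \<le> ?D + 1"
    unfolding choice_number_def by (rule Least_le)
  \<comment> \<open>The maximum is the maximum degree in the first case and 4 in the second.\<close>
  then show ?thesis using degen by (auto simp: max_def split: if_splits)
qed

end
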